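(* Let $p$ be a prime, let $q$ and $n$ be positive integers, let $T(p,q)$ be the torus link and $R_n$ the dihedral quandle of order $n$. If $n$ is prime and $|\operatorname{Hom}(Q(T(p,q)),R_n)|=n^p$, then the full quandle coloring quiver of $T(p,q)$ with respect to $R_n$ is (isomorphic to) the directed graph $$\mathcal{Q}_{R_n}(T(p,q))=(\overleftrightarrow{K_n},\hat n)\,\overleftarrow{\nabla}\,\Big[\bigsqcup_{m}\left(\overleftrightarrow{K_{n(n-1)}},\hat 1\right)\Big],\qquad m=\frac{n^p-n}{n(n-1)}.$$
   Context: A quandle is a set $X$ with a binary operation $*$ such that $(x*y)*z=(x*z)*(y*z)$ for all $x,y,z$; for each $x$ the map $R_x:X\to X$, $y\mapsto y*x$, is a bijection; and $x*x=x$ for all $x$. Write $x\bar{*}y=R_y^{-1}(x)$. The dihedral quandle $R_n$ is $\mathbb{Z}_n=\mathbb{Z}/n\mathbb{Z}$ with $x*y=2y-x \pmod n$. A quandle homomorphism is a map preserving $*$. For an oriented link $K$ with diagram $D$, the fundamental quandle $Q(K)$ is the quandle generated by the arcs of $D$ with one relation per crossing: if $y$ is the over-arc and $x,z$ are the incoming and outgoing under-arcs, then $z=x*y$ at a positive crossing and $z=x\bar{*}y$ at a negative crossing. $\operatorname{Hom}(Q(K),X)$ is the set of quandle homomorphisms $Q(K)\to X$; it is identified with the set of colorings of $D$ by $X$, i.e. maps from arcs to $X$ satisfying the crossing relations. The torus link $T(p,q)$ is the closure of the $p$-strand braid $(\sigma_1\sigma_2\cdots\sigma_{p-1})^q$.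 The full quandle coloring quiver $\mathcal{Q}_X(K)$ of $K$ with respect to a finite quandle $X$ is the directed multigraph with vertex set $\operatorname{Hom}(Q(K),X)$ and, for each vertex $f$ and each quandle endomorphism $\phi:X\to X$, one directed edge from $f$ to $\phi\circ f$. Notation: $(\overleftrightarrow{K_m},\hat\omega)$ is the directed multigraph on $m$ vertices with exactly $\omega$ directed edges from each vertex to each vertex (including from each vertex to itself). $\bigsqcup_{m}G$ is the disjoint union of $m$ copies of $G$ (no edges between different copies). For directed multigraphs $G_1,G_2$ with disjoint vertex and edge sets, $G_1\overleftarrow{\nabla}G_2$ is the union of $G_1$ and $G_2$ together with exactly one directed edge from each vertex of $G_2$ to each vertex of $G_1$ (and no edges from $G_1$ to $G_2$). Equality of directed multigraphs means isomorphism. *)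

theory Defs
  imports
    "HOL-Algebra.Congruence"
    "HOL-Library.FuncSet"
    "HOL-Computational_Algebra.Primes"
    "Graph_Theory.Digraph_Isomorphism"
begin

section \<open>Quandles\<close>

record 'a quandle_struct = "'a partial_object" +
  qop :: "'a \<Rightarrow> 'a \<Rightarrow> 'a" (infixl "\<star>\<index>" 70)

locale quandle =
  fixes X (structure)
  assumes closed: "\<lbrakk>x \<in> carrier X; y \<in> carrier X\<rbrakk> \<Longrightarrow> x \<star> y \<in> carrier X"
    and self_distrib: "\<lbrakk>x \<in> carrier X; y \<in> carrier X; z \<in> carrier X\<rbrakk>
      \<Longrightarrow> (x \<star> y) \<star> z = (x \<star> z) \<star> (y \<star> z)"
    and right_mult_bij: "x \<in> carrier X \<Longrightarrow> bij_betw (\<lambda>y. y \<star> x) (carrier X) (carrier X)"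
    and idem: "x \<in> carrier X \<Longrightarrow> x \<star> x = x"

definition qbar :: "('a, 'm) quandle_struct_scheme \<Rightarrow> 'a \<Rightarrow> 'a \<Rightarrow> 'a" where
  "qbar X x y = the_inv_into (carrier X) (\<lambda>z. z \<star>\<^bsub>X\<^esub> y) x"

text \<open>Homomorphisms are taken to be extensional (\<open>undefined\<close> off the carrier), so that
  they can be counted and compared by equality of HOL functions.\<close>

definition quandle_hom ::
  "('a, 'm) quandle_struct_scheme \<Rightarrow> ('b, 'k) quandle_struct_scheme \<Rightarrow> ('a \<Rightarrow> 'b) set" where
  "quandle_hom X Y = {f \<in> carrier X \<rightarrow>\<^sub>E carrier Y.
     \<forall>x \<in> carrier X. \<forall>y \<in> carrier X. f (x \<star>\<^bsub>X\<^esub> y) = f x \<star>\<^bsub>Y\<^esub> f y}"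

definition dihedral_quandle :: "nat \<Rightarrow> int quandle_struct" where
  "dihedral_quandle n = \<lparr>carrier = {0..<int n}, qop = (\<lambda>x y. (2 * y - x) mod int n)\<rparr>"

lemma quandle_dihedral_quandle:
  assumes "n > 0"
  shows "quandle (dihedral_quandle n)"
proof -
  have inv: "(2 * x - (2 * x - y) mod int n) mod int n = y" if "y \<in> {0..<int n}" for x y
    using that by (simp add: mod_diff_right_eq)
  show ?thesis
  proof
    fix x y z assume "x \<in> carrier (dihedral_quandle n)" "y \<in> carrier (dihedral_quandle n)"
      "z \<in> carrier (dihedral_quandle n)"
    have "(2 * ((2 * z - y) mod int n) - (2 * z - x) mod int n) mod int n
        = (2 * (2 * z - y) - (2 * z - x)) mod int n"
      by (rule mod_diff_cong) (simp_all add: mod_mult_right_eq)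
    also have "2 * (2 * z - y) - (2 * z - x) = 2 * z - (2 * y - x)"
      by simp
    also have "\<dots> mod int n = (2 * z - (2 * y - x) mod int n) mod int n"
      by (simp only: mod_simps)
    finally show "x \<star>\<^bsub>dihedral_quandle n\<^esub> y \<star>\<^bsub>dihedral_quandle n\<^esub> z =
        x \<star>\<^bsub>dihedral_quandle n\<^esub> z \<star>\<^bsub>dihedral_quandle n\<^esub> (y \<star>\<^bsub>dihedral_quandle n\<^esub> z)"
      by (simp add: dihedral_quandle_def)
  next
    fix x assume "x \<in> carrier (dihedral_quandle n)"
    show "bij_betw (\<lambda>y. y \<star>\<^bsub>dihedral_quandle n\<^esub> x) (carrier (dihedral_quandle n))
        (carrier (dihedral_quandle n))"
      by (rule bij_betw_byWitness[where f' = "\<lambda>y. (2 * x - y) mod int n"])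
        (use assms inv in \<open>auto simp: dihedral_quandle_def\<close>)
  qed (use assms in \<open>auto simp: dihedral_quandle_def\<close>)
qed

section \<open>Fundamental quandle of an oriented link diagram\<close>

datatype crossing_sign = Positive | Negative

datatype 'a crossing =
  Crossing (crossing_sign: crossing_sign) (over_arc: 'a) (under_in: 'a) (under_out: 'a)

record 'a link_diagram =
  diagram_arcs :: "'a set"
  diagram_crossings :: "'a crossing set"

definition wf_diagram :: "'a link_diagram \<Rightarrow> bool" where
  "wf_diagram D \<longleftrightarrow> (\<forall>c \<in> diagram_crossings D. set_crossing c \<subseteq> diagram_arcs D)"

text \<open>Quandle words in the arcs; \<open>QBar\<close> is the operation written $\bar{*}$.\<close>

datatype 'a qterm = Arc 'a | QOp "'a qterm" "'a qterm" | QBar "'a qterm" "'a qterm"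

definition qterms :: "'a link_diagram \<Rightarrow> 'a qterm set" where
  "qterms D = {t. set_qterm t \<subseteq> diagram_arcs D}"

text \<open>The congruence generated by the quandle axioms and the crossing relations.
  \<open>bar_op\<close> and \<open>op_bar\<close> say that $x \mapsto x \mathbin{\bar{*}} y$ is a two-sided inverse
  of $x \mapsto x * y$, i.e. that right multiplications are bijective.\<close>

inductive qterm_eq :: "'a link_diagram \<Rightarrow> 'a qterm \<Rightarrow> 'a qterm \<Rightarrow> bool" for D where
  refl: "t \<in> qterms D \<Longrightarrow> qterm_eq D t t"
| sym: "qterm_eq D s t \<Longrightarrow> qterm_eq D t s"
| trans: "qterm_eq D s t \<Longrightarrow> qterm_eq D t u \<Longrightarrow> qterm_eq D s u"
| op_cong: "qterm_eq D s s' \<Longrightarrow> qterm_eq D t t' \<Longrightarrow> qterm_eq D (QOp s t) (QOp s' t')"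
| bar_cong: "qterm_eq D s s' \<Longrightarrow> qterm_eq D t t' \<Longrightarrow> qterm_eq D (QBar s t) (QBar s' t')"
| idem: "t \<in> qterms D \<Longrightarrow> qterm_eq D (QOp t t) t"
| bar_op: "s \<in> qterms D \<Longrightarrow> t \<in> qterms D \<Longrightarrow> qterm_eq D (QBar (QOp s t) t) s"
| op_bar: "s \<in> qterms D \<Longrightarrow> t \<in> qterms D \<Longrightarrow> qterm_eq D (QOp (QBar s t) t) s"
| distrib: "s \<in> qterms D \<Longrightarrow> t \<in> qterms D \<Longrightarrow> u \<in> qterms D
    \<Longrightarrow> qterm_eq D (QOp (QOp s t) u) (QOp (QOp s u) (QOp t u))"
| positive: "Crossing Positive y x z \<in> diagram_crossings D
    \<Longrightarrow> qterm_eq D (Arc z) (QOp (Arc x) (Arc y))"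
| negative: "Crossing Negative y x z \<in> diagram_crossings D
    \<Longrightarrow> qterm_eq D (Arc z) (QBar (Arc x) (Arc y))"

definition qterm_rel :: "'a link_diagram \<Rightarrow> ('a qterm \<times> 'a qterm) set" where
  "qterm_rel D = {(s, t). qterm_eq D s t}"

definition fundamental_quandle :: "'a link_diagram \<Rightarrow> 'a qterm set quandle_struct" where
  "fundamental_quandle D =
    \<lparr>carrier = qterms D // qterm_rel D,
     qop = (\<lambda>A B. \<Union>s \<in> A. \<Union>t \<in> B. qterm_rel D `` {QOp s t})\<rparr>"

definition colorings ::
  "'a link_diagram \<Rightarrow> ('b, 'm) quandle_struct_scheme \<Rightarrow> ('a \<Rightarrow> 'b) set" where
  "colorings D X = {c \<in> diagram_arcs D \<rightarrow>\<^sub>E carrier X.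
     \<forall>k \<in> diagram_crossings D. c (under_out k) =
       (case crossing_sign k of
          Positive \<Rightarrow> c (under_in k) \<star>\<^bsub>X\<^esub> c (over_arc k)
        | Negative \<Rightarrow> qbar X (c (under_in k)) (c (over_arc k)))}"

lemma qterms_simps [simp]:
  "Arc a \<in> qterms D \<longleftrightarrow> a \<in> diagram_arcs D"
  "QOp s t \<in> qterms D \<longleftrightarrow> s \<in> qterms D \<and> t \<in> qterms D"
  "QBar s t \<in> qterms D \<longleftrightarrow> s \<in> qterms D \<and> t \<in> qterms D"
  by (auto simp: qterms_def)

lemma wf_diagramD:
  assumes "wf_diagram D" "Crossing e y x z \<in> diagram_crossings D"
  shows "x \<in> diagram_arcs D" "y \<in> diagram_arcs D" "z \<in> diagram_arcs D"
  using assms(1)[unfolded wf_diagram_def, rule_format, OF assms(2)] by simp_all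

lemma qterm_eq_in_qterms:
  assumes "wf_diagram D" "qterm_eq D s t"
  shows "s \<in> qterms D \<and> t \<in> qterms D"
  using assms(2)
  by induction (simp_all add: wf_diagramD[OF assms(1)])

lemma equiv_qterm_rel:
  assumes "wf_diagram D"
  shows "equiv (qterms D) (qterm_rel D)"
proof (rule equivI)
  show "qterm_rel D \<subseteq> qterms D \<times> qterms D"
    using qterm_eq_in_qterms[OF assms] by (auto simp: qterm_rel_def)
  show "refl_on (qterms D) (qterm_rel D)"
    by (simp add: refl_on_def qterm_rel_def qterm_eq.refl)
  show "Relation.sym (qterm_rel D)"
    unfolding qterm_rel_def sym_def by (blast intro: qterm_eq.sym)
  show "Relation.trans (qterm_rel D)"
    unfolding qterm_rel_def trans_def by (blast intro: qterm_eq.trans)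
qed

lemma fundamental_quandle_op:
  assumes "wf_diagram D" "s \<in> qterms D" "t \<in> qterms D"
  shows "qterm_rel D `` {s} \<star>\<^bsub>fundamental_quandle D\<^esub> qterm_rel D `` {t}
    = qterm_rel D `` {QOp s t}"
proof -
  note E = equiv_qterm_rel[OF assms(1)]
  have "congruent2 (qterm_rel D) (qterm_rel D) (\<lambda>s t. qterm_rel D `` {QOp s t})"
  proof (rule congruent2I')
    fix s s' t t' assume "(s, s') \<in> qterm_rel D" "(t, t') \<in> qterm_rel D"
    then have "(QOp s t, QOp s' t') \<in> qterm_rel D"
      by (simp add: qterm_rel_def qterm_eq.op_cong)
    then show "qterm_rel D `` {QOp s t} = qterm_rel D `` {QOp s' t'}"
      by (rule equiv_class_eq[OF E])
  qed
  note eq = UN_equiv_class2[OF E E this assms(2,3)]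
  show ?thesis
    using eq by (simp only: fundamental_quandle_def quandle_struct.simps)
qed

lemma fundamental_quandle_carrier_cases:
  assumes "A \<in> carrier (fundamental_quandle D)"
  obtains s where "s \<in> qterms D" "A = qterm_rel D `` {s}"
  using assms unfolding fundamental_quandle_def partial_object.simps
  by (rule quotientE) (rule that)

lemma fundamental_quandle_class_in [simp]:
  "s \<in> qterms D \<Longrightarrow> qterm_rel D `` {s} \<in> carrier (fundamental_quandle D)"
  by (simp add: fundamental_quandle_def quotientI)

lemma qterm_class_eqI:
  assumes "wf_diagram D" "qterm_eq D s t"
  shows "qterm_rel D `` {s} = qterm_rel D `` {t}"
  by (rule equiv_class_eq[OF equiv_qterm_rel[OF assms(1)]]) (simp add: qterm_rel_def assms(2))

lemma quandle_fundamental_quandle: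
  assumes wf: "wf_diagram D"
  shows "quandle (fundamental_quandle D)"
proof
  note op = fundamental_quandle_op[OF wf]
  let ?Q = "fundamental_quandle D" and ?c = "\<lambda>s. qterm_rel D `` {s}"
  fix A assume "A \<in> carrier ?Q"
  then obtain s where s: "s \<in> qterms D" and A: "A = ?c s"
    by (rule fundamental_quandle_carrier_cases)
  show "A \<star>\<^bsub>?Q\<^esub> A = A"
    unfolding A op[OF s s] by (rule qterm_class_eqI[OF wf qterm_eq.idem[OF s]])
  have closed: "B \<star>\<^bsub>?Q\<^esub> A \<in> carrier ?Q" if "B \<in> carrier ?Q" for B
  proof -
    from that obtain t where t: "t \<in> qterms D" and B: "B = ?c t"
      by (rule fundamental_quandle_carrier_cases)
    show ?thesis unfolding A B op[OF t s] using s t by simp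
  qed
  show "bij_betw (\<lambda>B. B \<star>\<^bsub>?Q\<^esub> A) (carrier ?Q) (carrier ?Q)"
    unfolding bij_betw_def
  proof (rule conjI, rule inj_onI, rule_tac[2] equalityI, rule_tac[2-3] subsetI)
    fix B C assume BC: "B \<in> carrier ?Q" "C \<in> carrier ?Q" and eq: "B \<star>\<^bsub>?Q\<^esub> A = C \<star>\<^bsub>?Q\<^esub> A"
    from BC(1) obtain t where t: "t \<in> qterms D" and B: "B = ?c t"
      by (rule fundamental_quandle_carrier_cases)
    from BC(2) obtain u where u: "u \<in> qterms D" and C: "C = ?c u"
      by (rule fundamental_quandle_carrier_cases)
    from eq have "?c (QOp t s) = ?c (QOp u s)"
      unfolding A B C op[OF t s] op[OF u s] .
    then have "(QOp t s, QOp u s) \<in> qterm_rel D"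
      by (rule eq_equiv_class[OF _ equiv_qterm_rel[OF wf]]) (simp add: s u)
    then have "qterm_eq D (QBar (QOp t s) s) (QBar (QOp u s) s)"
      by (intro qterm_eq.bar_cong qterm_eq.refl[OF s]) (simp add: qterm_rel_def)
    with qterm_eq.sym[OF qterm_eq.bar_op[OF t s]] have "qterm_eq D t (QBar (QOp u s) s)"
      by (rule qterm_eq.trans)
    from this qterm_eq.bar_op[OF u s] have "qterm_eq D t u"
      by (rule qterm_eq.trans)
    then show "B = C" unfolding B C by (rule qterm_class_eqI[OF wf])
  next
    fix B assume "B \<in> (\<lambda>B. B \<star>\<^bsub>?Q\<^esub> A) ` carrier ?Q"
    then show "B \<in> carrier ?Q" using closed by blast
  next
    fix B assume "B \<in> carrier ?Q"
    then obtain t where t: "t \<in> qterms D" and B: "B = ?c t"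
      by (rule fundamental_quandle_carrier_cases)
    have ts: "QBar t s \<in> qterms D" using t s by simp
    have "?c (QBar t s) \<star>\<^bsub>?Q\<^esub> A = B"
      unfolding A B op[OF ts s] by (rule qterm_class_eqI[OF wf qterm_eq.op_bar[OF t s]])
    then show "B \<in> (\<lambda>B. B \<star>\<^bsub>?Q\<^esub> A) ` carrier ?Q"
      using fundamental_quandle_class_in[OF ts] by blast
  qed
  fix B assume "B \<in> carrier ?Q"
  then obtain t where t: "t \<in> qterms D" and B: "B = ?c t"
    by (rule fundamental_quandle_carrier_cases)
  show "A \<star>\<^bsub>?Q\<^esub> B \<in> carrier ?Q"
    unfolding A B op[OF s t] using s t by simp
  fix C assume "C \<in> carrier ?Q"
  then obtain u where u: "u \<in> qterms D" and C: "C = ?c u"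
    by (rule fundamental_quandle_carrier_cases)
  show "A \<star>\<^bsub>?Q\<^esub> B \<star>\<^bsub>?Q\<^esub> C = A \<star>\<^bsub>?Q\<^esub> C \<star>\<^bsub>?Q\<^esub> (B \<star>\<^bsub>?Q\<^esub> C)"
    using s t u qterm_class_eqI[OF wf qterm_eq.distrib[OF s t u]] by (simp add: A B C op)
qed

primrec qeval ::
  "('b, 'm) quandle_struct_scheme \<Rightarrow> ('a \<Rightarrow> 'b) \<Rightarrow> 'a qterm \<Rightarrow> 'b" where
  "qeval X c (Arc a) = c a"
| "qeval X c (QOp s t) = qeval X c s \<star>\<^bsub>X\<^esub> qeval X c t"
| "qeval X c (QBar s t) = qbar X (qeval X c s) (qeval X c t)"

context quandle
begin

lemma qbar_closed: "\<lbrakk>x \<in> carrier X; y \<in> carrier X\<rbrakk> \<Longrightarrow> qbar X x y \<in> carrier X"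
  unfolding qbar_def using right_mult_bij[of y]
  by (auto simp: bij_betw_def intro!: the_inv_into_into)

lemma qbar_op: "\<lbrakk>x \<in> carrier X; y \<in> carrier X\<rbrakk> \<Longrightarrow> qbar X (x \<star> y) y = x"
  unfolding qbar_def using right_mult_bij[of y]
  by (auto simp: bij_betw_def intro!: the_inv_into_f_f)

lemma op_qbar: "\<lbrakk>x \<in> carrier X; y \<in> carrier X\<rbrakk> \<Longrightarrow> qbar X x y \<star> y = x"
  unfolding qbar_def using right_mult_bij[of y]
  by (auto simp: bij_betw_def intro!: f_the_inv_into_f[where f = "\<lambda>z. z \<star> y"])

lemma qeval_closed:
  assumes "c \<in> colorings D X" "t \<in> qterms D"
  shows "qeval X c t \<in> carrier X"
  using assms(2)
proof (induction t)
  case (Arc a)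
  then show ?case using assms(1) by (auto simp: colorings_def)
qed (auto simp: closed qbar_closed)

lemma qeval_cong:
  assumes wf: "wf_diagram D" and c: "c \<in> colorings D X" and eq: "qterm_eq D s t"
  shows "qeval X c s = qeval X c t"
  using eq
proof induction
  case (distrib s t u)
  then show ?case using qeval_closed[OF c] by (simp add: self_distrib)
next
  case (positive y x z)
  then show ?case using c by (force simp: colorings_def)
next
  case (negative y x z)
  then show ?case using c by (force simp: colorings_def)
qed (use qeval_closed[OF c] in \<open>auto simp: idem qbar_op op_qbar\<close>)

text \<open>The identification of \<open>Hom(Q(K), X)\<close> with the colorings of the diagram.\<close>

theorem hom_fundamental_quandle_colorings:
  assumes wf: "wf_diagram D"
  shows "bij_betw (\<lambda>f. \<lambda>a\<in>diagram_arcs D. f (qterm_rel D `` {Arc a}))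
    (quandle_hom (fundamental_quandle D) X) (colorings D X)"
proof -
  let ?Q = "fundamental_quandle D"
  let ?r = "\<lambda>f. \<lambda>a\<in>diagram_arcs D. f (qterm_rel D `` {Arc a})"
  note op = fundamental_quandle_op[OF wf]
  interpret Q: quandle ?Q by (rule quandle_fundamental_quandle[OF wf])
  have hom_class: "f (qterm_rel D `` {s}) \<in> carrier X"
    if "f \<in> quandle_hom ?Q X" "s \<in> qterms D" for f s
    using that by (auto simp: quandle_hom_def)
  have hom_op: "f (qterm_rel D `` {QOp s t})
      = f (qterm_rel D `` {s}) \<star> f (qterm_rel D `` {t})"
    if "f \<in> quandle_hom ?Q X" "s \<in> qterms D" "t \<in> qterms D" for f s t
  proof -
    have "f (qterm_rel D `` {s} \<star>\<^bsub>?Q\<^esub> qterm_rel D `` {t})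
        = f (qterm_rel D `` {s}) \<star> f (qterm_rel D `` {t})"
      using that by (simp add: quandle_hom_def)
    then show ?thesis using that by (simp add: op)
  qed
  have hom_bar: "f (qterm_rel D `` {QBar s t})
      = qbar X (f (qterm_rel D `` {s})) (f (qterm_rel D `` {t}))"
    if "f \<in> quandle_hom ?Q X" "s \<in> qterms D" "t \<in> qterms D" for f s t
  proof -
    have "f (qterm_rel D `` {s}) = f (qterm_rel D `` {QBar s t}) \<star> f (qterm_rel D `` {t})"
      using hom_op[OF that(1), of "QBar s t" t] that
      by (simp add: qterm_class_eqI[OF wf qterm_eq.op_bar])
    then show ?thesis using hom_class[OF that(1)] that by (simp add: qbar_op)
  qed
  have hom_eval: "f (qterm_rel D `` {t}) = qeval X (?r f) t"
    if "f \<in> quandle_hom ?Q X" "t \<in> qterms D" for f t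
    using that(2)
    by (induction t) (auto simp: hom_op[OF that(1)] hom_bar[OF that(1)])
  have col: "?r f \<in> colorings D X" if f: "f \<in> quandle_hom ?Q X" for f
  proof -
    have "?r f (under_out k) = (case crossing_sign k of
          Positive \<Rightarrow> ?r f (under_in k) \<star> ?r f (over_arc k)
        | Negative \<Rightarrow> qbar X (?r f (under_in k)) (?r f (over_arc k)))"
      if k: "k \<in> diagram_crossings D" for k
    proof (cases k)
      case (Crossing e y x z)
      then have in_arcs: "x \<in> diagram_arcs D" "y \<in> diagram_arcs D" "z \<in> diagram_arcs D"
        using wf_diagramD[OF wf, of e y x z] k by simp_all
      show ?thesis
      proof (cases e)
        case Positive
        then show ?thesis using Crossing k in_arcs hom_op[OF f, of "Arc x" "Arc y"]
            qterm_class_eqI[OF wf qterm_eq.positive, of y x z] by simp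
      next
        case Negative
        then show ?thesis using Crossing k in_arcs hom_bar[OF f, of "Arc x" "Arc y"]
            qterm_class_eqI[OF wf qterm_eq.negative, of y x z] by simp
      qed
    qed
    then show ?thesis using hom_class[OF f] by (auto simp: colorings_def)
  qed
  have inj: "inj_on ?r (quandle_hom ?Q X)"
  proof (rule inj_onI)
    fix f g assume fg: "f \<in> quandle_hom ?Q X" "g \<in> quandle_hom ?Q X" "?r f = ?r g"
    show "f = g"
    proof (rule extensionalityI[where A = "carrier ?Q"])
      fix A assume "A \<in> carrier ?Q"
      then obtain s where s: "s \<in> qterms D" "A = qterm_rel D `` {s}"
        by (rule fundamental_quandle_carrier_cases)
      then show "f A = g A"
        by (simp only: hom_eval[OF fg(1)] hom_eval[OF fg(2)] fg(3))
    qed (use fg(1,2) in \<open>auto simp: quandle_hom_def PiE_def\<close>)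
  qed
  have surj: "c \<in> ?r ` quandle_hom ?Q X" if c: "c \<in> colorings D X" for c
  proof -
    define f where "f = (\<lambda>A \<in> carrier ?Q. the_elem (qeval X c ` A))"
    have f_class: "f (qterm_rel D `` {s}) = qeval X c s" if s: "s \<in> qterms D" for s
    proof -
      have "\<forall>u \<in> qterm_rel D `` {s}. qeval X c u = qeval X c s"
        by (auto simp: qterm_rel_def dest: qeval_cong[OF wf c])
      moreover have "s \<in> qterm_rel D `` {s}"
        using qterm_eq.refl[OF s] by (simp add: qterm_rel_def)
      ultimately have "qeval X c ` (qterm_rel D `` {s}) = {qeval X c s}"
        by blast
      then show ?thesis using s by (simp add: f_def)
    qed
    have "f \<in> quandle_hom ?Q X"
      unfolding quandle_hom_def
    proof (intro CollectI conjI ballI PiE_I)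
      fix A assume "A \<in> carrier ?Q"
      then show "f A \<in> carrier X"
        by (elim fundamental_quandle_carrier_cases) (simp add: f_class qeval_closed[OF c])
    next
      fix A B assume "A \<in> carrier ?Q" "B \<in> carrier ?Q"
      then show "f (A \<star>\<^bsub>?Q\<^esub> B) = f A \<star> f B"
        by (elim fundamental_quandle_carrier_cases) (simp add: op f_class)
    qed (auto simp: f_def)
    moreover have "?r f = c"
    proof (rule extensionalityI[where A = "diagram_arcs D"])
      show "c \<in> extensional (diagram_arcs D)"
        using c by (simp add: colorings_def PiE_def)
    qed (simp_all add: f_class)
    ultimately show ?thesis by blast
  qed
  show ?thesis
    unfolding bij_betw_def using inj col surj by blast
qed

end

section \<open>Closed braids and torus links\<close>

text \<open>\<open>Gen i\<close> is $\sigma_i$ and \<open>Gen_inv i\<close> is $\sigma_i^{-1}$. Braids are drawn upwards with all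
  strands oriented upwards and positions \<open>1, \<dots>, p\<close> numbered from left to right. In $\sigma_i$
  the strand going from position \<open>i\<close> to \<open>i + 1\<close> passes over the one going from \<open>i + 1\<close>
  to \<open>i\<close>; this is a positive crossing.\<close>

datatype braid_gen = Gen nat | Gen_inv nat

text \<open>In both cases the over-strand goes from \<open>over_pos\<close> to \<open>under_pos\<close> and the under-strand
  from \<open>under_pos\<close> to \<open>over_pos\<close>.\<close>

fun over_pos :: "braid_gen \<Rightarrow> nat" where
  "over_pos (Gen i) = i"
| "over_pos (Gen_inv i) = Suc i"

fun under_pos :: "braid_gen \<Rightarrow> nat" where
  "under_pos (Gen i) = Suc i"
| "under_pos (Gen_inv i) = i"

fun gen_sign :: "braid_gen \<Rightarrow> crossing_sign" where
  "gen_sign (Gen i) = Positive"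
| "gen_sign (Gen_inv i) = Negative"

text \<open>The point \<open>(k, j)\<close> lies on the strand at position \<open>j\<close>, after the first \<open>k\<close> letters of the
  word. Two points are joined if they are connected by a piece of the closed braid containing
  no undercrossing; the arcs of the diagram are the classes of the equivalence relation so
  generated. The last set of pairs comes from closing up the braid.\<close>

definition braid_points :: "nat \<Rightarrow> braid_gen list \<Rightarrow> (nat \<times> nat) set" where
  "braid_points p w = {0..length w} \<times> {1..p}"

definition braid_joins :: "nat \<Rightarrow> braid_gen list \<Rightarrow> ((nat \<times> nat) \<times> (nat \<times> nat)) set" where
  "braid_joins p w =
     {((k, j), (Suc k, j)) | k j.
        k < length w \<and> j \<in> {1..p} \<and> j \<noteq> over_pos (w ! k) \<and> j \<noteq> under_pos (w ! k)}
   \<union> {((k, over_pos (w ! k)), (Suc k, under_pos (w ! k))) | k. k < length w}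
   \<union> {((length w, j), (0, j)) | j. j \<in> {1..p}}"

definition braid_arc_rel :: "nat \<Rightarrow> braid_gen list \<Rightarrow> ((nat \<times> nat) \<times> (nat \<times> nat)) set" where
  "braid_arc_rel p w = (braid_joins p w \<union> (braid_joins p w)\<inverse>)\<^sup>*"

definition braid_arc :: "nat \<Rightarrow> braid_gen list \<Rightarrow> nat \<times> nat \<Rightarrow> (nat \<times> nat) set" where
  "braid_arc p w x = braid_arc_rel p w `` {x}"

definition braid_closure :: "nat \<Rightarrow> braid_gen list \<Rightarrow> (nat \<times> nat) set link_diagram" where
  "braid_closure p w =
    \<lparr>diagram_arcs = braid_points p w // braid_arc_rel p w,
     diagram_crossings =
       (\<lambda>k. Crossing (gen_sign (w ! k))
              (braid_arc p w (k, over_pos (w ! k)))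
              (braid_arc p w (k, under_pos (w ! k)))
              (braid_arc p w (Suc k, over_pos (w ! k)))) ` {0..<length w}\<rparr>"

definition braid_word :: "nat \<Rightarrow> braid_gen list \<Rightarrow> bool" where
  "braid_word p w \<longleftrightarrow> (\<forall>g \<in> set w. over_pos g \<in> {1..p} \<and> under_pos g \<in> {1..p})"

lemma wf_braid_closure:
  assumes "braid_word p w"
  shows "wf_diagram (braid_closure p w)"
  using assms
  by (auto simp: wf_diagram_def braid_closure_def braid_arc_def braid_points_def braid_word_def
      intro!: quotientI)

definition torus_braid :: "nat \<Rightarrow> nat \<Rightarrow> braid_gen list" where
  "torus_braid p q = concat (replicate q (map Gen [1..<p]))"

definition torus_link :: "nat \<Rightarrow> nat \<Rightarrow> (nat \<times> nat) set link_diagram" where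
  "torus_link p q = braid_closure p (torus_braid p q)"

lemma wf_torus_link: "wf_diagram (torus_link p q)"
  unfolding torus_link_def
  by (rule wf_braid_closure) (auto simp: braid_word_def torus_braid_def)

section \<open>Directed multigraphs and coloring quivers\<close>

definition full_coloring_quiver ::
  "('b, 'm) quandle_struct_scheme \<Rightarrow> 'a link_diagram
    \<Rightarrow> ('a qterm set \<Rightarrow> 'b, ('a qterm set \<Rightarrow> 'b) \<times> ('b \<Rightarrow> 'b)) pre_digraph" where
  "full_coloring_quiver X D =
    \<lparr>verts = quandle_hom (fundamental_quandle D) X,
     arcs = quandle_hom (fundamental_quandle D) X \<times> quandle_hom X X,
     tail = fst,
     head = (\<lambda>(f, \<phi>). compose (carrier (fundamental_quandle D)) \<phi> f)\<rparr>"

definition complete_multidigraph :: "nat \<Rightarrow> nat \<Rightarrow> (nat, nat \<times> nat \<times> nat) pre_digraph" where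
  "complete_multidigraph m \<omega> =
    \<lparr>verts = {..<m}, arcs = {..<m} \<times> {..<m} \<times> {..<\<omega>},
     tail = (\<lambda>(u, v, i). u), head = (\<lambda>(u, v, i). v)\<rparr>"

definition disjoint_copies :: "nat \<Rightarrow> ('v, 'e) pre_digraph \<Rightarrow> (nat \<times> 'v, nat \<times> 'e) pre_digraph" where
  "disjoint_copies m G =
    \<lparr>verts = {..<m} \<times> verts G, arcs = {..<m} \<times> arcs G,
     tail = map_prod id (tail G), head = map_prod id (head G)\<rparr>"

text \<open>$G_1 \overleftarrow{\nabla} G_2$, with the summands made disjoint by tagging; the arc
  \<open>Inr (Inr (v, u))\<close> goes from the vertex \<open>v\<close> of $G_2$ to the vertex \<open>u\<close> of $G_1$.\<close>

definition left_join ::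
  "('v, 'e) pre_digraph \<Rightarrow> ('w, 'f) pre_digraph \<Rightarrow> ('v + 'w, 'e + 'f + 'w \<times> 'v) pre_digraph" where
  "left_join G1 G2 =
    \<lparr>verts = verts G1 <+> verts G2,
     arcs = arcs G1 <+> (arcs G2 <+> verts G2 \<times> verts G1),
     tail = case_sum (Inl \<circ> tail G1) (case_sum (Inr \<circ> tail G2) (Inr \<circ> fst)),
     head = case_sum (Inl \<circ> head G1) (case_sum (Inr \<circ> head G2) (Inl \<circ> snd))\<rparr>"

text \<open>The natural-number division giving the number of copies in the main theorem is exact.\<close>

lemma copies_exact:
  fixes n p :: nat
  assumes "n > 0" "p > 0"
  shows "n * (n - 1) dvd n ^ p - n"
proof -
  obtain r where r: "p = Suc r" using assms(2) gr0_implies_Suc by blast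
  have "int (n - 1) dvd int (n ^ r - 1)"
    using assms(1) power_diff_1_eq[of "int n" r] by (simp add: of_nat_diff Suc_leI)
  then have "n - 1 dvd n ^ r - 1" by (simp only: of_nat_dvd_iff)
  then have "n * (n - 1) dvd n * (n ^ r - 1)" by (rule mult_dvd_mono[OF dvd_refl])
  then show ?thesis by (simp add: r right_diff_distrib')
qed

end

(* Since n is prime, an endomorphism of R_n is determined by its values at any two distinct points,
   and these values can be prescribed arbitrarily. So the n^2 endomorphisms act freely on each
   nonconstant coloring f, and the orbit of f consists of the n constant colorings and n(n-1)
   nonconstant ones; exactly n endomorphisms carry a given constant coloring to another one.
   These are the arc multiplicities of the join. The link enters only through the number of
   its colorings. *)

theory Submission
  imports
    Defs
    "HOL-Number_Theory.Cong"
begin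

section \<open>Arc multiplicities and isomorphism of directed multigraphs\<close>

definition arc_mult :: "('v, 'e) pre_digraph \<Rightarrow> 'v \<Rightarrow> 'v \<Rightarrow> nat" where
  "arc_mult G u v = card {e \<in> arcs G. tail G e = u \<and> head G e = v}"

text \<open>Arcs carry no data beyond their two ends, so bijections between the arc sets over
  corresponding pairs of vertices glue to a bijection of all arcs. Finiteness turns equal
  cardinalities into such bijections; \<open>card\<close> is 0 on every infinite set.\<close>

lemma digraph_isoI_arc_mult:
  assumes G: "wf_digraph G" "finite (arcs G)" and H: "wf_digraph H" "finite (arcs H)"
    and h: "bij_betw h (verts G) (verts H)"
    and mult: "\<And>u v. \<lbrakk>u \<in> verts G; v \<in> verts G\<rbrakk> \<Longrightarrow> arc_mult G u v = arc_mult H (h u) (h v)"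
  shows "digraph_iso G H"
proof -
  interpret G: wf_digraph G by (rule G(1))
  interpret H: wf_digraph H by (rule H(1))
  let ?A = "\<lambda>u v. {e \<in> arcs G. tail G e = u \<and> head G e = v}"
  let ?B = "\<lambda>u v. {e \<in> arcs H. tail H e = u \<and> head H e = v}"
  have ex: "\<exists>k. bij_betw k (?A u v) (?B (h u) (h v))" if "u \<in> verts G" "v \<in> verts G" for u v
    using G(2) H(2) mult[OF that] by (intro finite_same_card_bij) (simp_all add: arc_mult_def)
  define k where "k u v = (SOME k. bij_betw k (?A u v) (?B (h u) (h v)))" for u v
  have k: "bij_betw (k u v) (?A u v) (?B (h u) (h v))" if "u \<in> verts G" "v \<in> verts G" for u v
    unfolding k_def by (rule someI_ex[OF ex[OF that]])
  \<comment> \<open>The ends of an arc select which of the chosen bijections applies to it.\<close>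
  define K where "K e = k (tail G e) (head G e) e" for e
  have K: "K e \<in> arcs H \<and> tail H (K e) = h (tail G e) \<and> head H (K e) = h (head G e)"
    if "e \<in> arcs G" for e
    using bij_betwE[OF k, of "tail G e" "head G e"] that by (auto simp: K_def)
  have h_inj: "h u = h v \<longleftrightarrow> u = v" if "u \<in> verts G" "v \<in> verts G" for u v
    using h that by (auto simp: bij_betw_def inj_on_eq_iff)
  have "inj_on K (arcs G)"
  proof (rule inj_onI)
    fix e e' assume e: "e \<in> arcs G" "e' \<in> arcs G" and eq: "K e = K e'"
    have ends: "tail G e = tail G e'" "head G e = head G e'"
      using K[OF e(1)] K[OF e(2)] eq e by (simp_all add: h_inj)
    have "inj_on (k (tail G e) (head G e)) (?A (tail G e) (head G e))"
      using k e(1) by (simp add: bij_betw_def)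
    then show "e = e'"
      by (rule inj_onD) (use e eq ends in \<open>auto simp: K_def\<close>)
  qed
  moreover have "K ` arcs G = arcs H"
  proof (intro equalityI subsetI)
    fix e assume e: "e \<in> arcs H"
    then obtain u v where uv: "u \<in> verts G" "v \<in> verts G" "h u = tail H e" "h v = head H e"
      using h H.wellformed[of e] unfolding bij_betw_def by (metis imageE)
    then have "e \<in> k u v ` ?A u v"
      using k[OF uv(1,2)] e by (simp add: bij_betw_def)
    then show "e \<in> K ` arcs G" by (auto simp: K_def)
  qed (use K in auto)
  ultimately show ?thesis
    unfolding digraph_iso_def
    \<comment> \<open>\<open>app_iso\<close> installs the \<open>tail\<close> and
      \<open>head\<close> functions found in the record; taking those of \<open>H\<close> makes the
      image literally equal to \<open>H\<close>.\<close>
    by (intro exI[of _ "\<lparr>iso_verts = h, iso_arcs = K, iso_head = head H, iso_tail = tail H\<rparr>"])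
      (use h K G(1) in \<open>auto simp: G.digraph_isomorphism_def app_iso_def bij_betw_def\<close>)
qed

lemma arc_mult_complete_multidigraph:
  assumes "u < m" "v < m"
  shows "arc_mult (complete_multidigraph m \<omega>) u v = \<omega>"
proof -
  have "{e \<in> {..<m} \<times> {..<m} \<times> {..<\<omega>}. (\<lambda>(u, v, i). u) e = u \<and> (\<lambda>(u, v, i). v) e = v}
      = {u} \<times> {v} \<times> {..<\<omega>}"
    using assms by auto
  then show ?thesis
    by (simp add: arc_mult_def complete_multidigraph_def)
qed

lemma arc_mult_disjoint_copies:
  assumes "i < m"
  shows "arc_mult (disjoint_copies m G) (i, u) (j, v) = (if i = j then arc_mult G u v else 0)"
proof -
  have "{e \<in> {..<m} \<times> arcs G. map_prod id (tail G) e = (i, u) \<and> map_prod id (head G) e = (j, v)}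
      = (if i = j then Pair i ` {e \<in> arcs G. tail G e = u \<and> head G e = v} else {})"
    using assms by auto
  then show ?thesis
    by (simp add: arc_mult_def disjoint_copies_def card_image inj_on_def)
qed

text \<open>The tag of an arc fixes the tags of its ends, so each pair of end tags meets at most one
  summand of the nested sum; a join arc is itself the pair of its ends, hence unique.\<close>

lemma arc_mult_left_join:
  "arc_mult (left_join G1 G2) (Inl u) (Inl v) = arc_mult G1 u v"
  "arc_mult (left_join G1 G2) (Inr x) (Inr y) = arc_mult G2 x y"
  "arc_mult (left_join G1 G2) (Inl u) (Inr y) = 0"
  "\<lbrakk>x \<in> verts G2; v \<in> verts G1\<rbrakk> \<Longrightarrow> arc_mult (left_join G1 G2) (Inr x) (Inl v) = 1"
proof -
  let ?S = "\<lambda>x y. {e \<in> arcs (left_join G1 G2).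
    tail (left_join G1 G2) e = x \<and> head (left_join G1 G2) e = y}"
  have "?S (Inl u) (Inl v) = Inl ` {e \<in> arcs G1. tail G1 e = u \<and> head G1 e = v}"
    by (auto simp: left_join_def)
  then show "arc_mult (left_join G1 G2) (Inl u) (Inl v) = arc_mult G1 u v"
    by (simp add: arc_mult_def card_image)
  have "?S (Inr x) (Inr y) = (Inr \<circ> Inl) ` {e \<in> arcs G2. tail G2 e = x \<and> head G2 e = y}"
    by (auto simp: left_join_def image_comp)
  then show "arc_mult (left_join G1 G2) (Inr x) (Inr y) = arc_mult G2 x y"
    by (simp add: arc_mult_def card_image inj_on_def)
  have "?S (Inl u) (Inr y) = {}"
    by (auto simp: left_join_def)
  then show "arc_mult (left_join G1 G2) (Inl u) (Inr y) = 0"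
    by (simp only: arc_mult_def card.empty)
  assume "x \<in> verts G2" "v \<in> verts G1"
  then have "?S (Inr x) (Inl v) = {Inr (Inr (x, v))}"
    by (auto simp: left_join_def)
  then show "arc_mult (left_join G1 G2) (Inr x) (Inl v) = 1"
    by (simp add: arc_mult_def)
qed

lemma wf_complete_multidigraph: "wf_digraph (complete_multidigraph m \<omega>)"
  by unfold_locales (auto simp: complete_multidigraph_def)

lemma wf_disjoint_copies:
  assumes "wf_digraph G"
  shows "wf_digraph (disjoint_copies m G)"
  using wf_digraph.wellformed[OF assms]
  by unfold_locales (auto simp: disjoint_copies_def)

lemma wf_left_join:
  assumes "wf_digraph G1" "wf_digraph G2"
  shows "wf_digraph (left_join G1 G2)"
  using wf_digraph.wellformed[OF assms(1)] wf_digraph.wellformed[OF assms(2)]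
  by unfold_locales (auto simp: left_join_def)

section \<open>Numbering a finite set with fibres of equal size\<close>

text \<open>One bijection numbers the fibres of \<open>\<kappa>\<close>, and one for each fibre
  numbers its elements. With orbits as fibres, the first coordinate becomes the index of a copy in
  the disjoint union.\<close>

lemma ex_bij_betw_equal_fibres:
  assumes "finite A" and fibre: "\<And>x. x \<in> A \<Longrightarrow> card {y \<in> A. \<kappa> y = \<kappa> x} = k"
  obtains h where "bij_betw h A ({..<card (\<kappa> ` A)} \<times> {..<k})"
    and "\<And>x y. \<lbrakk>x \<in> A; y \<in> A\<rbrakk> \<Longrightarrow> fst (h x) = fst (h y) \<longleftrightarrow> \<kappa> x = \<kappa> y"
proof -
  obtain a where a: "bij_betw a (\<kappa> ` A) {..<card (\<kappa> ` A)}"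
    using finite_same_card_bij[of "\<kappa> ` A" "{..<card (\<kappa> ` A)}"] assms(1) by auto
  have "\<exists>b. bij_betw b {y \<in> A. \<kappa> y = c} {..<k}" if "c \<in> \<kappa> ` A" for c
    using that assms by (intro finite_same_card_bij) auto
  then obtain b where b: "\<And>c. c \<in> \<kappa> ` A \<Longrightarrow> bij_betw (b c) {y \<in> A. \<kappa> y = c} {..<k}"
    by metis
  define h where "h x = (a (\<kappa> x), b (\<kappa> x) x)" for x
  have a_inj: "a (\<kappa> x) = a (\<kappa> y) \<longleftrightarrow> \<kappa> x = \<kappa> y" if "x \<in> A" "y \<in> A" for x y
    using a that by (auto simp: bij_betw_def inj_on_eq_iff)
  have "inj_on h A"
  proof (rule inj_onI)
    fix x y assume xy: "x \<in> A" "y \<in> A" "h x = h y"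
    then have eq: "\<kappa> y = \<kappa> x" "b (\<kappa> x) x = b (\<kappa> x) y"
      using a_inj[of x y] by (auto simp: h_def)
    have "inj_on (b (\<kappa> x)) {y \<in> A. \<kappa> y = \<kappa> x}"
      using b[of "\<kappa> x"] xy(1) by (simp add: bij_betw_def)
    then show "x = y" by (rule inj_onD) (use xy eq in auto)
  qed
  moreover have "h ` A = {..<card (\<kappa> ` A)} \<times> {..<k}"
  proof (intro equalityI subsetI)
    fix z assume "z \<in> h ` A"
    then obtain x where x: "x \<in> A" "z = h x" by auto
    then show "z \<in> {..<card (\<kappa> ` A)} \<times> {..<k}"
      using bij_betwE[OF a] bij_betwE[OF b[of "\<kappa> x"]] by (simp add: h_def)
  next
    fix z assume z: "z \<in> {..<card (\<kappa> ` A)} \<times> {..<k}"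
    then have "fst z \<in> a ` \<kappa> ` A" using a by (auto simp: bij_betw_def)
    then obtain c where c: "c \<in> \<kappa> ` A" "fst z = a c" by blast
    have "snd z \<in> b c ` {y \<in> A. \<kappa> y = c}"
      using b[OF c(1)] z by (auto simp: bij_betw_def)
    then obtain y where "y \<in> A" "\<kappa> y = c" "snd z = b c y" by blast
    then show "z \<in> h ` A"
      using c by (intro image_eqI[of _ _ y] prod_eqI) (simp_all add: h_def)
  qed
  ultimately show thesis
    using a_inj by (intro that[of h]) (auto simp: bij_betw_def h_def)
qed

section \<open>Endomorphisms of prime order dihedral quandles\<close>

lemma dihedral_quandle_simps [simp]:
  "carrier (dihedral_quandle n) = {0..<int n}"
  "x \<star>\<^bsub>dihedral_quandle n\<^esub> y = (2 * y - x) mod int n"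
  by (simp_all add: dihedral_quandle_def)

text \<open>Distinct representatives differ by less than \<open>n\<close> in absolute value, so the
  prime \<open>n\<close> does not divide the difference and is coprime to it.\<close>

lemma ex_inverse_mod_prime:
  assumes "prime n" "x \<in> {0..<int n}" "y \<in> {0..<int n}" "x \<noteq> y"
  obtains w where "[(y - x) * w = 1] (mod int n)"
proof -
  have "\<not> int n dvd y - x"
  proof
    assume "int n dvd y - x"
    moreover have "\<bar>y - x\<bar> < int n" using assms(2,3) by auto
    ultimately show False using assms(4) dvd_imp_le_int[of "y - x" "int n"] by auto
  qed
  moreover have "prime (int n)" using assms(1) by simp
  ultimately have "coprime (int n) (y - x)" by (metis prime_imp_coprime)
  then show thesis
    using that cong_solve_coprime_int[of "y - x" "int n"] by (auto simp: coprime_commute)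
qed

text \<open>The progression \<open>x, y, 2y - x, \<dots>\<close> is generated by \<open>x\<close> and \<open>y\<close> under the quandle operation
  and runs through all residues.\<close>

lemma dihedral_hom_eqI:
  assumes "prime n" and xy: "x \<in> {0..<int n}" "y \<in> {0..<int n}" "x \<noteq> y"
    and \<phi>: "\<phi> \<in> quandle_hom (dihedral_quandle n) Y" and \<psi>: "\<psi> \<in> quandle_hom (dihedral_quandle n) Y"
    and eq: "\<phi> x = \<psi> x" "\<phi> y = \<psi> y"
  shows "\<phi> = \<psi>"
proof (rule extensionalityI[of _ "{0..<int n}"])
  show "\<phi> \<in> extensional {0..<int n}" "\<psi> \<in> extensional {0..<int n}"
    using \<phi> \<psi> by (auto simp: quandle_hom_def PiE_def)
  have n: "int n > 0" using assms(1) prime_gt_0_nat by simp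
  define s where "s k = (x + int k * (y - x)) mod int n" for k
  have s_step: "s (Suc (Suc k)) = s k \<star>\<^bsub>dihedral_quandle n\<^esub> s (Suc k)" for k
  proof -
    have "(2 * s (Suc k) - s k) mod int n
        = (2 * (x + int (Suc k) * (y - x)) - (x + int k * (y - x))) mod int n"
      unfolding s_def cong_def[symmetric]
      by (intro cong_diff cong_mult cong_refl) (simp_all add: cong_def)
    then show ?thesis by (simp add: s_def algebra_simps)
  qed
  have s_in: "s k \<in> {0..<int n}" for k using n by (simp add: s_def)
  \<comment> \<open>The recursion for \<open>s\<close> reaches back two terms, so the induction
    carries agreement at two consecutive ones.\<close>
  have s_eq: "\<phi> (s k) = \<psi> (s k) \<and> \<phi> (s (Suc k)) = \<psi> (s (Suc k))" for k
  proof (induction k)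
    case 0
    then show ?case using xy eq by (simp add: s_def)
  next
    case (Suc k)
    have "\<chi> (s (Suc (Suc k))) = \<chi> (s k) \<star>\<^bsub>Y\<^esub> \<chi> (s (Suc k))"
      if "\<chi> \<in> quandle_hom (dihedral_quandle n) Y" for \<chi>
      using that s_in[of k] s_in[of "Suc k"] unfolding s_step by (simp add: quandle_hom_def)
    from this[OF \<phi>] this[OF \<psi>] show ?case using Suc by simp
  qed
  fix z assume z: "z \<in> {0..<int n}"
  obtain w where w: "[(y - x) * w = 1] (mod int n)"
    by (rule ex_inverse_mod_prime[OF assms(1) xy])
  \<comment> \<open>The solution of \<open>x + k * (y - x) = z\<close> modulo \<open>n\<close>,
    reduced to a nonnegative residue so that it can index \<open>s\<close>.\<close>
  define k where "k = nat (((z - x) * w) mod int n)"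
  have "[int k * (y - x) = (z - x) * w * (y - x)] (mod int n)"
    using n unfolding k_def by (intro cong_mult) (simp_all add: cong_def)
  also have "(z - x) * w * (y - x) = (z - x) * ((y - x) * w)" by simp
  also have "[(z - x) * ((y - x) * w) = (z - x) * 1] (mod int n)"
    by (rule cong_mult[OF cong_refl w])
  finally have "[x + int k * (y - x) = x + (z - x) * 1] (mod int n)"
    by (rule cong_add[OF cong_refl])
  then have "s k = z" using z by (simp add: s_def cong_def)
  then show "\<phi> z = \<psi> z" using s_eq[of k] by simp
qed

text \<open>Affine maps modulo \<open>n\<close> preserve \<open>2 * v - u\<close>, because the
  coefficients 2 and -1 add up to 1; the required one interpolates the two prescribed
  values.\<close>

lemma ex_dihedral_endomorphism:
  assumes "prime n" and xy: "x \<in> {0..<int n}" "y \<in> {0..<int n}" "x \<noteq> y"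
    and st: "s \<in> {0..<int n}" "t \<in> {0..<int n}"
  shows "\<exists>\<phi> \<in> quandle_hom (dihedral_quandle n) (dihedral_quandle n). \<phi> x = s \<and> \<phi> y = t"
proof -
  have n: "int n > 0" using assms(1) prime_gt_0_nat by simp
  obtain w where w: "[(y - x) * w = 1] (mod int n)"
    by (rule ex_inverse_mod_prime[OF assms(1) xy])
  \<comment> \<open>The slope \<open>(t - s) / (y - x)\<close> modulo \<open>n\<close>, with
    \<open>w\<close> as the inverse of the denominator.\<close>
  define a where "a = w * (t - s)"
  define \<phi> where "\<phi> = (\<lambda>z\<in>{0..<int n}. (s + (z - x) * a) mod int n)"
  have "\<phi> ((2 * v - u) mod int n) = (2 * \<phi> v - \<phi> u) mod int n"
    if "u \<in> {0..<int n}" "v \<in> {0..<int n}" for u v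
  proof -
    have "\<phi> ((2 * v - u) mod int n) = (s + ((2 * v - u) mod int n - x) * a) mod int n"
      using n by (simp add: \<phi>_def)
    also have "\<dots> = (s + (2 * v - u - x) * a) mod int n"
      unfolding cong_def[symmetric]
      by (intro cong_add cong_diff cong_mult cong_refl) (simp_all add: cong_def)
    also have "s + (2 * v - u - x) * a = 2 * (s + (v - x) * a) - (s + (u - x) * a)"
      by (simp add: algebra_simps)
    also have "\<dots> mod int n = (2 * ((s + (v - x) * a) mod int n) - (s + (u - x) * a) mod int n) mod int n"
      unfolding cong_def[symmetric]
      by (intro cong_diff cong_mult cong_refl) (simp_all add: cong_def)
    finally show ?thesis using that by (simp add: \<phi>_def)
  qed
  then have "\<phi> \<in> quandle_hom (dihedral_quandle n) (dihedral_quandle n)"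
    using n by (auto simp: quandle_hom_def \<phi>_def)
  moreover have "\<phi> x = s" using xy st by (simp add: \<phi>_def)
  moreover have "\<phi> y = t"
  proof -
    have "[s + (y - x) * w * (t - s) = s + 1 * (t - s)] (mod int n)"
      by (intro cong_add cong_mult w cong_refl)
    then show ?thesis using xy st by (simp add: \<phi>_def a_def cong_def mult.assoc)
  qed
  ultimately show ?thesis by blast
qed

text \<open>Uniqueness and existence of interpolating endomorphisms combined; every later count of
  endomorphisms is read off from this bijection.\<close>

lemma bij_betw_dihedral_endomorphism_values:
  assumes "prime n" "x \<in> {0..<int n}" "y \<in> {0..<int n}" "x \<noteq> y"
  shows "bij_betw (\<lambda>\<phi>. (\<phi> x, \<phi> y)) (quandle_hom (dihedral_quandle n) (dihedral_quandle n))
    ({0..<int n} \<times> {0..<int n})"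
  unfolding bij_betw_def
proof (intro conjI inj_onI equalityI subsetI)
  fix \<phi> \<psi> assume "\<phi> \<in> quandle_hom (dihedral_quandle n) (dihedral_quandle n)"
    "\<psi> \<in> quandle_hom (dihedral_quandle n) (dihedral_quandle n)" "(\<phi> x, \<phi> y) = (\<psi> x, \<psi> y)"
  then show "\<phi> = \<psi>" by (intro dihedral_hom_eqI[OF assms]) auto
next
  fix z assume "z \<in> {0..<int n} \<times> {0..<int n}"
  then obtain \<phi> where "\<phi> \<in> quandle_hom (dihedral_quandle n) (dihedral_quandle n)"
    "\<phi> x = fst z" "\<phi> y = snd z"
    using ex_dihedral_endomorphism[OF assms, of "fst z" "snd z"] by auto
  then show "z \<in> (\<lambda>\<phi>. (\<phi> x, \<phi> y)) ` quandle_hom (dihedral_quandle n) (dihedral_quandle n)"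
    by (intro image_eqI[of _ _ \<phi>]) simp_all
next
  fix z assume "z \<in> (\<lambda>\<phi>. (\<phi> x, \<phi> y)) ` quandle_hom (dihedral_quandle n) (dihedral_quandle n)"
  then show "z \<in> {0..<int n} \<times> {0..<int n}"
    using assms(2,3) by (auto simp: quandle_hom_def PiE_def Pi_def)
qed

lemma ex_ne_dihedral:
  assumes "prime n"
  obtains y where "y \<in> {0..<int n}" "y \<noteq> x"
proof -
  have "1 < int n" using prime_gt_1_nat[OF assms] by simp
  then show thesis using that[of 0] that[of 1] by fastforce
qed

lemma card_dihedral_endomorphisms:
  assumes "prime n"
  shows "card (quandle_hom (dihedral_quandle n) (dihedral_quandle n)) = n * n"
proof -
  have 0: "0 \<in> {0..<int n}" using prime_gt_0_nat[OF assms] by simp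
  obtain y where "y \<in> {0..<int n}" "y \<noteq> 0" using ex_ne_dihedral[OF assms] .
  then show ?thesis
    using bij_betw_same_card[OF bij_betw_dihedral_endomorphism_values[OF assms 0, of y]] by simp
qed

lemma finite_dihedral_endomorphisms:
  assumes "prime n"
  shows "finite (quandle_hom (dihedral_quandle n) (dihedral_quandle n))"
  using card_dihedral_endomorphisms[OF assms] prime_gt_0_nat[OF assms]
  by (intro card_ge_0_finite) simp

text \<open>Fixing the value at \<open>c\<close> leaves the value at a second point \<open>y\<close>
  free, which gives \<open>n\<close> choices.\<close>

lemma card_dihedral_endomorphisms_value:
  assumes "prime n" "c \<in> {0..<int n}" "d \<in> {0..<int n}"
  shows "card {\<phi> \<in> quandle_hom (dihedral_quandle n) (dihedral_quandle n). \<phi> c = d} = n"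
proof -
  obtain y where y: "y \<in> {0..<int n}" "y \<noteq> c" using ex_ne_dihedral[OF assms(1)] .
  let ?E = "quandle_hom (dihedral_quandle n) (dihedral_quandle n)" and ?e = "\<lambda>\<phi>. (\<phi> c, \<phi> y)"
  have bij: "bij_betw ?e ?E ({0..<int n} \<times> {0..<int n})"
    by (rule bij_betw_dihedral_endomorphism_values[OF assms(1,2) y(1) y(2)[symmetric]])
  have "?e ` {\<phi> \<in> ?E. \<phi> c = d} = {d} \<times> {0..<int n}"
  proof (intro equalityI subsetI)
    fix z assume z: "z \<in> {d} \<times> {0..<int n}"
    then have "z \<in> ?e ` ?E" using bij assms(3) by (auto simp: bij_betw_def)
    then show "z \<in> ?e ` {\<phi> \<in> ?E. \<phi> c = d}" using z by auto
  qed (use bij in \<open>auto simp: bij_betw_def\<close>)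
  with bij have "bij_betw ?e {\<phi> \<in> ?E. \<phi> c = d} ({d} \<times> {0..<int n})"
    by (auto simp: bij_betw_def intro: inj_on_subset)
  from bij_betw_same_card[OF this] show ?thesis by simp
qed

section \<open>The action of the endomorphisms on the colorings\<close>

context
  fixes Q :: "('a, 'm) quandle_struct_scheme" and n :: nat
  assumes Q: "quandle Q" "carrier Q \<noteq> {}" and n: "prime n"
begin

private abbreviation (input) "V \<equiv> quandle_hom Q (dihedral_quandle n)"
private abbreviation (input) "E \<equiv> quandle_hom (dihedral_quandle n) (dihedral_quandle n)"
private abbreviation (input) "act \<equiv> compose (carrier Q)"

definition const_hom :: "int \<Rightarrow> 'a \<Rightarrow> int" where
  "const_hom c = (\<lambda>x\<in>carrier Q. c)"

definition const_homs :: "('a \<Rightarrow> int) set" where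
  "const_homs = const_hom ` {0..<int n}"

text \<open>The endomorphisms form a monoid that contains the constant maps, not a group. Orbits are
  therefore not automatically equivalence classes: the orbit of every homomorphism contains all
  constant ones.\<close>

definition endo_orbit :: "('a \<Rightarrow> int) \<Rightarrow> ('a \<Rightarrow> int) set" where
  "endo_orbit f = (\<lambda>\<phi>. act \<phi> f) ` E"

text \<open>A point of the carrier separates the constants; over an empty carrier all of them would
  coincide.\<close>

lemma const_hom_eq_iff: "const_hom c = const_hom d \<longleftrightarrow> c = d"
proof
  obtain x where "x \<in> carrier Q" using Q(2) by auto
  moreover assume "const_hom c = const_hom d"
  then have "const_hom c x = const_hom d x" by simp
  ultimately show "c = d" by (simp add: const_hom_def)
qed simp

lemma card_const_homs: "card const_homs = n"
  by (simp add: const_homs_def card_image inj_on_def const_hom_eq_iff)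

text \<open>Constant maps are homomorphisms by idempotence, here
  \<open>2 * c - c = c\<close>.\<close>

lemma const_homs_subset: "const_homs \<subseteq> V"
  using quandle.closed[OF Q(1)]
  by (auto simp: const_homs_def const_hom_def quandle_hom_def)

lemma compose_const_hom: "act \<phi> (const_hom c) = const_hom (\<phi> c)"
  by (rule ext) (simp add: const_hom_def compose_def)

lemma compose_hom:
  assumes "\<phi> \<in> E" "f \<in> V"
  shows "act \<phi> f \<in> V"
  using assms quandle.closed[OF Q(1)] by (auto simp: quandle_hom_def compose_def PiE_iff)

lemma compose_endo:
  assumes "\<phi> \<in> E" "\<psi> \<in> E"
  shows "compose {0..<int n} \<phi> \<psi> \<in> E"
  using assms prime_gt_0_nat[OF n] by (auto simp: quandle_hom_def compose_def PiE_iff)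

lemma compose_compose_endo:
  assumes "f \<in> V"
  shows "act \<phi> (act \<psi> f) = act (compose {0..<int n} \<phi> \<psi>) f"
  by (rule ext) (use assms in \<open>auto simp: compose_def quandle_hom_def PiE_iff\<close>)

lemma nonconst_homE:
  assumes "f \<in> V" "f \<notin> const_homs"
  obtains x y where "x \<in> carrier Q" "y \<in> carrier Q" "f x \<noteq> f y"
proof -
  obtain x where x: "x \<in> carrier Q" using Q(2) by auto
  have fx: "f x \<in> {0..<int n}" using assms(1) x by (auto simp: quandle_hom_def PiE_iff)
  have "\<exists>y \<in> carrier Q. f x \<noteq> f y"
  proof (rule ccontr)
    assume "\<not> ?thesis"
    then have "f = const_hom (f x)"
      by (intro extensionalityI[of _ "carrier Q"])
        (use assms(1) in \<open>auto simp: const_hom_def quandle_hom_def PiE_def\<close>)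
    then show False using assms(2) fx by (auto simp: const_homs_def)
  qed
  then show thesis using x that by blast
qed

text \<open>A nonconstant \<open>f\<close> takes two distinct values, the composite reveals
  \<open>\<phi>\<close> at both of them, and these two values determine
  \<open>\<phi>\<close>.\<close>

lemma inj_on_compose_nonconst_hom:
  assumes "f \<in> V" "f \<notin> const_homs"
  shows "inj_on (\<lambda>\<phi>. act \<phi> f) E"
proof (rule inj_onI)
  fix \<phi> \<psi> assume E: "\<phi> \<in> E" "\<psi> \<in> E" and eq: "act \<phi> f = act \<psi> f"
  obtain x y where xy: "x \<in> carrier Q" "y \<in> carrier Q" "f x \<noteq> f y"
    using nonconst_homE[OF assms] .
  have *: "f z \<in> {0..<int n}" "\<phi> (f z) = \<psi> (f z)" if "z \<in> carrier Q" for z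
    using that assms(1) fun_cong[OF eq, of z] by (auto simp: quandle_hom_def PiE_iff compose_eq)
  show "\<phi> = \<psi>"
    by (rule dihedral_hom_eqI[OF n *(1)[OF xy(1)] *(1)[OF xy(2)] xy(3) E *(2)[OF xy(1)] *(2)[OF xy(2)]])
qed

lemma card_endo_orbit:
  assumes "f \<in> V" "f \<notin> const_homs"
  shows "card (endo_orbit f) = n * n"
  using inj_on_compose_nonconst_hom[OF assms]
  by (simp add: endo_orbit_def card_image card_dihedral_endomorphisms[OF n])

lemma finite_endo_orbit: "finite (endo_orbit f)"
  by (simp add: endo_orbit_def finite_dihedral_endomorphisms[OF n])

lemma endo_orbit_subset: "f \<in> V \<Longrightarrow> endo_orbit f \<subseteq> V"
  using compose_hom by (auto simp: endo_orbit_def)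

text \<open>Constant self-maps of the dihedral quandle are endomorphisms, and composing one with
  \<open>f\<close> gives the constant homomorphism of the same value. This is the source of the join
  arcs.\<close>

lemma const_homs_subset_endo_orbit:
  assumes "f \<in> V"
  shows "const_homs \<subseteq> endo_orbit f"
proof
  fix g assume "g \<in> const_homs"
  then obtain c where c: "c \<in> {0..<int n}" "g = const_hom c"
    by (auto simp: const_homs_def)
  let ?\<phi> = "\<lambda>x\<in>{0..<int n}. c"
  have "?\<phi> \<in> E" using c prime_gt_0_nat[OF n] by (auto simp: quandle_hom_def)
  moreover have "g = act ?\<phi> f"
    by (rule ext) (use assms c in \<open>auto simp: const_hom_def compose_def quandle_hom_def PiE_iff\<close>)
  ultimately show "g \<in> endo_orbit f" by (auto simp: endo_orbit_def)
qed

lemma self_in_endo_orbit: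
  assumes "f \<in> V"
  shows "f \<in> endo_orbit f"
proof -
  let ?\<phi> = "\<lambda>x\<in>{0..<int n}. x"
  have "?\<phi> \<in> E" using prime_gt_0_nat[OF n] by (auto simp: quandle_hom_def)
  moreover have "f = act ?\<phi> f"
    by (rule ext) (use assms in \<open>auto simp: compose_def quandle_hom_def PiE_iff extensional_def\<close>)
  ultimately show ?thesis by (auto simp: endo_orbit_def)
qed

text \<open>Symmetry of the orbit relation comes from counting: nested orbits of nonconstant
  homomorphisms coincide because both have \<open>n\<^sup>2\<close> elements.\<close>

lemma endo_orbit_eq_iff:
  assumes f: "f \<in> V" "f \<notin> const_homs" and g: "g \<in> V" "g \<notin> const_homs"
  shows "endo_orbit g = endo_orbit f \<longleftrightarrow> g \<in> endo_orbit f"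
proof
  assume "g \<in> endo_orbit f"
  then obtain \<phi> where \<phi>: "\<phi> \<in> E" "g = act \<phi> f" by (auto simp: endo_orbit_def)
  then have "endo_orbit g \<subseteq> endo_orbit f"
    using f(1) compose_endo by (auto simp: endo_orbit_def compose_compose_endo)
  then show "endo_orbit g = endo_orbit f"
    by (rule card_subset_eq[OF finite_endo_orbit]) (simp add: card_endo_orbit f g)
qed (use self_in_endo_orbit[OF g(1)] in simp)

text \<open>The fibre is the orbit of \<open>f\<close> without its \<open>n\<close> constant
  members, and \<open>n * n - n = n * (n - 1)\<close>. It becomes the vertex set of one copy of the
  complete graph.\<close>

lemma card_endo_orbit_fibre:
  assumes "f \<in> V - const_homs"
  shows "card {g \<in> V - const_homs. endo_orbit g = endo_orbit f} = n * (n - 1)"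
proof -
  have "{g \<in> V - const_homs. endo_orbit g = endo_orbit f} = endo_orbit f - const_homs"
    using assms endo_orbit_subset[of f] endo_orbit_eq_iff[of f] by blast
  moreover have "finite const_homs" by (simp add: const_homs_def)
  ultimately show ?thesis
    using assms const_homs_subset_endo_orbit
    by (simp add: card_Diff_subset card_endo_orbit card_const_homs right_diff_distrib')
qed

text \<open>The action on the constant homomorphism with value \<open>c\<close> depends only on
  \<open>\<phi> c\<close>, and \<open>n\<close> endomorphisms have a prescribed value at
  \<open>c\<close>.\<close>

lemma card_endo_const_hom:
  assumes "f \<in> const_homs" "g \<in> const_homs"
  shows "card {\<phi> \<in> E. act \<phi> f = g} = n"
proof -
  obtain c d where cd: "c \<in> {0..<int n}" "f = const_hom c" "d \<in> {0..<int n}" "g = const_hom d"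
    using assms by (auto simp: const_homs_def)
  then show ?thesis
    using card_dihedral_endomorphisms_value[OF n cd(1,3)]
    by (simp only: compose_const_hom const_hom_eq_iff)
qed

text \<open>Endomorphisms keep constant homomorphisms constant, so no arcs lead from the constant
  part to the rest.\<close>

lemma card_endo_const_hom_nonconst:
  assumes "f \<in> const_homs" "g \<notin> const_homs"
  shows "card {\<phi> \<in> E. act \<phi> f = g} = 0"
proof -
  obtain c where c: "c \<in> {0..<int n}" "f = const_hom c"
    using assms by (auto simp: const_homs_def)
  have "act \<phi> f \<in> const_homs" if "\<phi> \<in> E" for \<phi>
    using that c by (auto simp: compose_const_hom const_homs_def quandle_hom_def PiE_iff)
  then have "{\<phi> \<in> E. act \<phi> f = g} = {}" using assms(2) by auto
  then show ?thesis by (simp only: card.empty)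
qed

text \<open>Injectivity of the action allows at most one endomorphism from \<open>f\<close> to
  \<open>g\<close>. This covers both the arcs inside a copy and the join arcs to the
  constants.\<close>

lemma card_endo_nonconst_hom:
  assumes "f \<in> V" "f \<notin> const_homs"
  shows "card {\<phi> \<in> E. act \<phi> f = g} = (if g \<in> endo_orbit f then 1 else 0)"
proof (cases "g \<in> endo_orbit f")
  case True
  then obtain \<phi> where \<phi>: "\<phi> \<in> E" "act \<phi> f = g" by (auto simp: endo_orbit_def)
  then have "{\<phi> \<in> E. act \<phi> f = g} = {\<phi>}"
    using inj_onD[OF inj_on_compose_nonconst_hom[OF assms]] by blast
  then show ?thesis using True by simp
next
  case False
  then have "{\<phi> \<in> E. act \<phi> f = g} = {}" by (auto simp: endo_orbit_def)
  then show ?thesis using False by (simp only: card.empty if_False)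
qed

end

section \<open>Structure of the full coloring quiver\<close>

lemma arc_mult_full_coloring_quiver:
  assumes "f \<in> quandle_hom (fundamental_quandle D) X"
  shows "arc_mult (full_coloring_quiver X D) f g
    = card {\<phi> \<in> quandle_hom X X. compose (carrier (fundamental_quandle D)) \<phi> f = g}"
proof -
  have "{e \<in> arcs (full_coloring_quiver X D).
        tail (full_coloring_quiver X D) e = f \<and> head (full_coloring_quiver X D) e = g}
      = Pair f ` {\<phi> \<in> quandle_hom X X. compose (carrier (fundamental_quandle D)) \<phi> f = g}"
    using assms by (auto simp: full_coloring_quiver_def)
  then show ?thesis by (simp add: arc_mult_def card_image inj_on_def)
qed

text \<open>Constant colorings are numbered by \<open>h1\<close> and nonconstant ones, orbit by
  orbit, by \<open>h2\<close>; it then suffices to compare arc multiplicities case by case.\<close>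

theorem full_coloring_quiver_dihedral_prime:
  assumes wf: "wf_diagram D" and ne: "diagram_arcs D \<noteq> {}" and n: "prime n"
    and fin: "finite (quandle_hom (fundamental_quandle D) (dihedral_quandle n))"
  shows "digraph_iso
    (full_coloring_quiver (dihedral_quandle n) D)
    (left_join (complete_multidigraph n n)
      (disjoint_copies
        ((card (quandle_hom (fundamental_quandle D) (dihedral_quandle n)) - n) div (n * (n - 1)))
        (complete_multidigraph (n * (n - 1)) 1)))"
proof -
  let ?Q = "fundamental_quandle D"
  let ?V = "quandle_hom ?Q (dihedral_quandle n)"
  let ?k = "n * (n - 1)"
  let ?G = "full_coloring_quiver (dihedral_quandle n) D"
  define C where "C = const_homs ?Q n"
  define orb where "orb = endo_orbit ?Q n"
  define m where "m = card (orb ` (?V - C))"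
  have Q: "quandle ?Q" by (rule quandle_fundamental_quandle[OF wf])
  \<comment> \<open>The class of an arc is a point of the fundamental quandle, which makes the
    \<open>n\<close> constant colorings distinct.\<close>
  obtain a where "a \<in> diagram_arcs D" using ne by auto
  then have "qterm_rel D `` {Arc a} \<in> carrier ?Q" by simp
  then have Q_ne: "carrier ?Q \<noteq> {}" by blast
  note Qn = Q Q_ne n
  have CV: "C \<subseteq> ?V" and card_C: "card C = n"
    unfolding C_def using const_homs_subset[OF Qn] card_const_homs[OF Qn] by simp_all
  have finC: "finite C" using CV fin by (rule finite_subset)
  obtain h1 where h1: "bij_betw h1 C {..<n}"
    using finite_same_card_bij[of C "{..<n}"] finC card_C by auto
  obtain h2 where h2: "bij_betw h2 (?V - C) ({..<m} \<times> {..<?k})"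
    and h2_fst: "\<And>f g. \<lbrakk>f \<in> ?V - C; g \<in> ?V - C\<rbrakk> \<Longrightarrow> fst (h2 f) = fst (h2 g) \<longleftrightarrow> orb f = orb g"
    unfolding m_def
    by (rule ex_bij_betw_equal_fibres[of "?V - C" orb ?k])
      (use fin card_endo_orbit_fibre[OF Qn] in \<open>auto simp: C_def orb_def\<close>)
  \<comment> \<open>The nonconstant colorings are counted by \<open>m\<close> orbits of
    \<open>?k\<close> elements each; \<open>?k\<close> is positive because a prime exceeds 1, so
    \<open>m\<close> is the quotient.\<close>
  have "card ?V - n = m * ?k"
    using bij_betw_same_card[OF h2] card_Diff_subset[OF finC CV] card_C by simp
  moreover have "?k > 0" using prime_gt_1_nat[OF n] by simp
  ultimately have m: "(card ?V - n) div ?k = m" by simp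
  define K where "K = disjoint_copies m (complete_multidigraph ?k 1)"
  define H where "H = left_join (complete_multidigraph n n) K"
  define h where "h f = (if f \<in> C then Inl (h1 f) else Inr (h2 f))" for f
  have verts_K: "verts K = {..<m} \<times> {..<?k}"
    by (simp add: K_def disjoint_copies_def complete_multidigraph_def)
  have verts_H: "verts H = {..<n} <+> ({..<m} \<times> {..<?k})"
    by (simp add: H_def left_join_def verts_K) (simp add: complete_multidigraph_def)
  have h1_in: "h1 f < n" if "f \<in> C" for f
    using bij_betwE[OF h1] that by simp
  have h2_in: "h2 f \<in> {..<m} \<times> {..<?k}" if "f \<in> ?V - C" for f
    using bij_betwE[OF h2] that by blast
  have "bij_betw h (C \<union> (?V - C)) (Inl ` {..<n} \<union> Inr ` ({..<m} \<times> {..<?k}))"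
  proof (rule bij_betw_combine)
    show "bij_betw h C (Inl ` {..<n})"
      using bij_betw_trans[OF h1, of Inl "Inl ` {..<n}"]
      by (rule bij_betw_cong[THEN iffD1, rotated]) (simp_all add: h_def bij_betw_def)
    show "bij_betw h (?V - C) (Inr ` ({..<m} \<times> {..<?k}))"
      using bij_betw_trans[OF h2, of Inr "Inr ` ({..<m} \<times> {..<?k})"]
      by (rule bij_betw_cong[THEN iffD1, rotated]) (simp_all add: h_def bij_betw_def)
  qed auto
  moreover have verts_G: "verts ?G = ?V"
    by (simp add: full_coloring_quiver_def)
  ultimately have h: "bij_betw h (verts ?G) (verts H)"
    using CV by (simp add: verts_H Plus_def Un_absorb1)
  have mult: "arc_mult ?G f g = arc_mult H (h f) (h g)" if f: "f \<in> ?V" and g: "g \<in> ?V" for f g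
  proof (cases "f \<in> C")
    case fC: True
    show ?thesis
    proof (cases "g \<in> C")
      case True
      then show ?thesis
        using fC card_endo_const_hom[OF Qn, of f g] h1_in[of f] h1_in[of g]
        by (simp add: arc_mult_full_coloring_quiver f h_def H_def arc_mult_left_join
            arc_mult_complete_multidigraph C_def)
    next
      case False
      then show ?thesis
        using fC card_endo_const_hom_nonconst[OF Qn fC[unfolded C_def] False[unfolded C_def]]
        unfolding arc_mult_full_coloring_quiver[OF f]
        by (simp only: h_def H_def arc_mult_left_join if_True if_False)
    qed
  next
    case fC: False
    then have mult_f: "arc_mult ?G f g = (if g \<in> orb f then 1 else 0)"
      using card_endo_nonconst_hom[OF Qn f, of g]
      unfolding arc_mult_full_coloring_quiver[OF f] C_def orb_def by blast
    have f_in: "h2 f \<in> verts K" using f fC h2_in verts_K by simp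
    show ?thesis
    proof (cases "g \<in> C")
      case True
      \<comment> \<open>Every constant coloring lies in the orbit of \<open>f\<close>, so the
        multiplicity is 1, matching the single join arc.\<close>
      then have "g \<in> orb f"
        using const_homs_subset_endo_orbit[OF Qn f] by (auto simp: C_def orb_def)
      moreover have "h1 g \<in> verts (complete_multidigraph n n)"
        using h1_in[OF True] by (simp add: complete_multidigraph_def)
      ultimately show ?thesis
        using fC True f_in by (simp add: mult_f h_def H_def arc_mult_left_join)
    next
      case gC: False
      obtain i u j v where h2fg: "h2 f = (i, u)" "h2 g = (j, v)"
        by (metis surj_pair)
      then have "i < m" "u < ?k" "v < ?k"
        using h2_in[of f] h2_in[of g] f fC g gC by auto
      then have "arc_mult K (h2 f) (h2 g) = (if i = j then 1 else 0)"
        by (simp add: K_def h2fg arc_mult_disjoint_copies arc_mult_complete_multidigraph)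
      \<comment> \<open>The first coordinates of \<open>h2\<close> number the orbits, so lying in
        the same copy means lying in the same orbit.\<close>
      moreover have "i = j \<longleftrightarrow> g \<in> orb f"
        using h2_fst[of f g] h2fg endo_orbit_eq_iff[OF Qn, of f g] f fC g gC
        by (auto simp: C_def orb_def)
      ultimately show ?thesis
        using fC gC by (simp add: mult_f h_def H_def arc_mult_left_join)
    qed
  qed
  have "digraph_iso ?G H"
  proof (rule digraph_isoI_arc_mult[OF _ _ _ _ h])
    show "wf_digraph ?G"
      by unfold_locales (auto simp: full_coloring_quiver_def intro: compose_hom[OF Qn])
    show "finite (arcs ?G)"
      using fin finite_dihedral_endomorphisms[OF n] by (simp add: full_coloring_quiver_def)
    show "wf_digraph H"
      unfolding H_def K_def
      by (intro wf_left_join wf_disjoint_copies wf_complete_multidigraph)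
    show "finite (arcs H)"
      by (simp add: H_def K_def left_join_def disjoint_copies_def complete_multidigraph_def)
  qed (simp add: verts_G mult)
  then show ?thesis by (simp only: H_def K_def m)
qed

theorem theorem4p4:
  fixes p q n :: nat
  assumes "prime p" and "q > 0" and "n > 0"
    and "prime n"
    and "card (quandle_hom (fundamental_quandle (torus_link p q)) (dihedral_quandle n)) = n ^ p"
  shows "digraph_iso
    (full_coloring_quiver (dihedral_quandle n) (torus_link p q))
    (left_join (complete_multidigraph n n)
      (disjoint_copies ((n ^ p - n) div (n * (n - 1))) (complete_multidigraph (n * (n - 1)) 1)))"
proof -
  \<comment> \<open>The bottom point of the first strand exists because \<open>p\<close> is
    positive; its class is an arc of the diagram.\<close>
  have "(0, 1) \<in> braid_points p (torus_braid p q)"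
    using prime_gt_0_nat[OF assms(1)] by (simp add: braid_points_def)
  then have "diagram_arcs (torus_link p q) \<noteq> {}"
    by (auto simp: torus_link_def braid_closure_def quotient_def)
  \<comment> \<open>An infinite set would have \<open>card\<close> equal to 0, whereas
    \<open>n ^ p\<close> is positive.\<close>
  moreover have "finite (quandle_hom (fundamental_quandle (torus_link p q)) (dihedral_quandle n))"
    using assms(3,5) by (intro card_ge_0_finite) simp
  ultimately show ?thesis
    by (rule full_coloring_quiver_dihedral_prime[OF wf_torus_link _ assms(4), of p q,
          unfolded assms(5)])
qed

end
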